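(* Let $a:[0,+\infty)\to[0,+\infty)$ be an interaction function with $\lim_{s\to0}s\,a(s)=0$, and let $M>0$. Let $R_i:=x_i-\bar x$ with $\bar x=\frac1N\sum_{j=1}^N x_j$, and let $i_V:=\arg\max_{i\in\{1,\dots,N\}}\|R_i\|$. Then the sparse feedback control $u^V$ defined by $u^V_i=M\frac{R_i}{\|R_i\|}$ for $i=i_V$ and $u^V_i=0$ for all $i\neq i_V$ prevents consensus for the system $$\dot x_i=\frac1N\sum_{j\neq i}a(\|x_i-x_j\|)(x_j-x_i)+u_i,\quad i\in\{1,\dots,N\}.$$ More specifically, there exists $\delta>0$ such that if $0<V(x(0))\leq\delta$, then the solution with control $u=u^V$ satisfies $V(x(t))>V(x(0))$ for all $t>0$.
   Context: $N\ge2$ agents, $x_i(t)\in\mathbb{R}^d$, $\|\cdot\|$ Euclidean norm. Variance: $V(x)=\frac{1}{2N^2}\sum_{i=1}^N\sum_{j=i+1}^N\|x_i-x_j\|^2$. Consensus is the state $x_1=\dots=x_N$, i.e. $V=0$. If several indices attain the maximum, $i_V$ is one of them (only one agent is controlled at a time). *)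

theory Defs
  imports "HOL-Analysis.Analysis"
begin

text \<open>A state of the \<open>N\<close> agents is a function \<open>x :: nat \<Rightarrow> real^'d\<close>, of which only the values
  at the indices \<open>1, \<dots>, N\<close> matter.\<close>

definition mean :: "nat \<Rightarrow> (nat \<Rightarrow> real^'d) \<Rightarrow> real^'d" where
  "mean N x = (1 / real N) *\<^sub>R (\<Sum>j=1..N. x j)"

definition deviation :: "nat \<Rightarrow> (nat \<Rightarrow> real^'d) \<Rightarrow> nat \<Rightarrow> real^'d" where
  "deviation N x i = x i - mean N x"

definition variance :: "nat \<Rightarrow> (nat \<Rightarrow> real^'d) \<Rightarrow> real" where
  "variance N x = (1 / (2 * (real N)\<^sup>2)) * (\<Sum>i=1..N. \<Sum>j=i+1..N. (norm (x i - x j))\<^sup>2)"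

definition consensus :: "nat \<Rightarrow> (nat \<Rightarrow> real^'d) \<Rightarrow> bool" where
  "consensus N x \<longleftrightarrow> (\<forall>i\<in>{1..N}. \<forall>j\<in>{1..N}. x i = x j)"

definition interaction :: "(real \<Rightarrow> real) \<Rightarrow> nat \<Rightarrow> (nat \<Rightarrow> real^'d) \<Rightarrow> nat \<Rightarrow> real^'d" where
  "interaction a N x i =
     (1 / real N) *\<^sub>R (\<Sum>j\<in>{1..N}-{i}. a (norm (x i - x j)) *\<^sub>R (x j - x i))"

text \<open>Since the feedback control below is discontinuous (and \<open>a\<close> need not be continuous),
  solutions are meant in the sense of Caratheodory. They are given by the integral form of the
  equation, with a Lebesgue integrable right-hand side: this says that every \<open>x\<^sub>i\<close> is absolutely
  continuous on each \<open>[0,t] \<subseteq> J\<close> and satisfies the differential equation almost everywhere.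
  \<open>J\<close> is any interval starting at \<open>0\<close>, such as \<open>[0,T]\<close>, \<open>[0,T)\<close> or \<open>[0,\<infinity>)\<close>.\<close>

definition solution_on ::
  "(real \<Rightarrow> real) \<Rightarrow> nat \<Rightarrow> real set \<Rightarrow> (real \<Rightarrow> nat \<Rightarrow> real^'d) \<Rightarrow> (real \<Rightarrow> nat \<Rightarrow> real^'d) \<Rightarrow> bool"
where
  "solution_on a N J x u \<longleftrightarrow>
     is_interval J \<and> 0 \<in> J \<and> J \<subseteq> {0..} \<and>
     (\<forall>i\<in>{1..N}. \<forall>t\<in>J.
        (\<lambda>s. interaction a N (x s) i + u s i) absolutely_integrable_on {0..t} \<and>
        ((\<lambda>s. interaction a N (x s) i + u s i) has_integral (x t i - x 0 i)) {0..t})"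

text \<open>The sparse feedback is a relation between the state and the control values, because
  \<open>i\<^sub>V\<close> may be any of the indices at which the maximum is attained. At consensus, where
  \<open>R\<^sub>i / \<parallel>R\<^sub>i\<parallel>\<close> is undefined, the convention \<open>M / 0 = 0\<close> yields the zero control.\<close>

definition sparse_feedback :: "real \<Rightarrow> nat \<Rightarrow> (nat \<Rightarrow> real^'d) \<Rightarrow> (nat \<Rightarrow> real^'d) \<Rightarrow> bool" where
  "sparse_feedback M N x u \<longleftrightarrow>
     (\<exists>iV. is_arg_max (\<lambda>i. norm (deviation N x i)) (\<lambda>i. i \<in> {1..N}) iV \<and>
       (\<forall>i\<in>{1..N}. u i = (if i = iV
           then (M / norm (deviation N x iV)) *\<^sub>R deviation N x iV else 0)))"

text \<open>Changing \<open>u\<close> on a null set does not affect \<open>solution_on\<close>, so requiring the feedback law at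
  every time of \<open>J\<close>, rather than at almost every time, admits the same trajectories.\<close>

definition closed_loop_solution ::
  "(real \<Rightarrow> real) \<Rightarrow> nat \<Rightarrow> ((nat \<Rightarrow> real^'d) \<Rightarrow> (nat \<Rightarrow> real^'d) \<Rightarrow> bool) \<Rightarrow> real set \<Rightarrow>
   (real \<Rightarrow> nat \<Rightarrow> real^'d) \<Rightarrow> bool"
where
  "closed_loop_solution a N F J x \<longleftrightarrow>
     (\<exists>u. solution_on a N J x u \<and> (\<forall>t\<in>J. F (x t) (u t)))"

text \<open>A feedback prevents consensus if no closed-loop solution starting outside consensus
  reaches it in finite time or converges to it asymptotically.\<close>

definition prevents_consensus ::
  "(real \<Rightarrow> real) \<Rightarrow> nat \<Rightarrow> ((nat \<Rightarrow> real^'d) \<Rightarrow> (nat \<Rightarrow> real^'d) \<Rightarrow> bool) \<Rightarrow> bool"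
where
  "prevents_consensus a N F \<longleftrightarrow>
     (\<forall>J x. closed_loop_solution a N F J x \<and> \<not> consensus N (x 0) \<longrightarrow>
        (\<forall>t\<in>J. \<not> consensus N (x t)) \<and>
        (J = {0..} \<longrightarrow> \<not> ((\<lambda>t. variance N (x t)) \<longlongrightarrow> 0) at_top))"

end

theory Submission
  imports Defs
begin

text \<open>Write \<open>R i\<close> for the deviations, so that \<open>2 * N * variance = (\<Sum>i. (norm (R i))\<^sup>2)\<close>. Near
  consensus each interaction term has norm at most \<open>M / (2 * N)\<close>, since \<open>s * a s\<close> is small, so its
  total contribution to \<open>\<Sum>i. R i \<bullet> x' i\<close> is at least \<open>- (M / 2) * Max (norm \<circ> R)\<close>, whereas the
  control contributes \<open>M * Max (norm \<circ> R)\<close>. Hence the variance increases. The product rule for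
  absolutely continuous functions is avoided by convexity of the squared norm:
  \<open>N * (variance (x s) - variance (x t)) \<ge> (\<Sum>i. R i t \<bullet> (x i s - x i t))\<close>, and the right-hand
  side is an integral with \<open>R\<close> frozen at time \<open>t\<close>. So the variance increases immediately to the
  right of every time at which it is small and positive, which by continuity makes every small
  positive level a barrier from below.\<close>

section \<open>Deviations from the mean and the variance\<close>

lemma sum_deviation:
  assumes "N > 0"
  shows "(\<Sum>i=1..N. deviation N x i) = 0"
  using assms by (simp add: deviation_def mean_def sum_subtractf sum_constant_scaleR
      del: sum_constant)

lemma diff_eq_deviation: "x i - x j = deviation N x i - deviation N x j"
  by (simp add: deviation_def)

text \<open>Passing from \<open>N\<close> to \<open>Suc N\<close> adds a last column to the
  triangle, but a last row and a last column to the square. These are equal by symmetry, and the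
  corner vanishes. This moves \<open>variance\<close> from pairs with \<open>i < j\<close> to the
  full square, where sums factor.\<close>

lemma double_sum_upper_triangle:
  fixes f :: "nat \<Rightarrow> nat \<Rightarrow> real"
  assumes sym: "\<And>i j. f i j = f j i" and diag: "\<And>i. f i i = 0"
  shows "(\<Sum>i=1..N. \<Sum>j=1..N. f i j) = 2 * (\<Sum>i=1..N. \<Sum>j=i+1..N. f i j)"
proof (induction N)
  case (Suc N)
  have "(\<Sum>i=1..Suc N. \<Sum>j=i+1..Suc N. f i j)
      = (\<Sum>i=1..N. (\<Sum>j=i+1..N. f i j) + f i (Suc N))"
    by simp
  then show ?case
    using Suc by (simp add: sum.distrib diag sym[of "Suc N"])
qed simp

text \<open>Expanding the squares over all pairs, the cross terms form the inner product of the sum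
  of the deviations with itself, and that sum is zero.\<close>

lemma variance_eq_sum_deviation:
  fixes x :: "nat \<Rightarrow> real^'d"
  assumes N: "N > 0"
  shows "variance N x = (1 / (2 * real N)) * (\<Sum>i=1..N. (norm (deviation N x i))\<^sup>2)"
proof -
  let ?R = "deviation N x"
  have "(\<Sum>i=1..N. \<Sum>j=1..N. (norm (x i - x j))\<^sup>2)
      = (\<Sum>i=1..N. \<Sum>j=1..N. (norm (?R i))\<^sup>2 + (norm (?R j))\<^sup>2 - 2 * (?R i \<bullet> ?R j))"
    by (intro sum.cong refl)
      (simp add: diff_eq_deviation[of x _ _ N] power2_norm_eq_inner inner_diff inner_commute)
  also have "\<dots> = 2 * real N * (\<Sum>i=1..N. (norm (?R i))\<^sup>2)
      - 2 * ((\<Sum>i=1..N. ?R i) \<bullet> (\<Sum>j=1..N. ?R j))"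
    by (simp add: sum.distrib sum_subtractf inner_sum_left inner_sum_right[symmetric]
        sum_distrib_left[symmetric])
  also have "\<dots> = 2 * real N * (\<Sum>i=1..N. (norm (?R i))\<^sup>2)"
    using sum_deviation[OF N, of x] by simp
  finally have "(\<Sum>i=1..N. \<Sum>j=i+1..N. (norm (x i - x j))\<^sup>2)
      = real N * (\<Sum>i=1..N. (norm (?R i))\<^sup>2)"
    using double_sum_upper_triangle[of "\<lambda>i j. (norm (x i - x j))\<^sup>2" N]
    by (simp add: norm_minus_commute)
  then show ?thesis
    using N by (simp add: variance_def power2_eq_square)
qed

lemma variance_nonneg: "variance N x \<ge> 0"
  by (simp add: variance_def sum_nonneg)

lemma variance_eq_0_iff_deviation:
  assumes "N > 0"
  shows "variance N x = 0 \<longleftrightarrow> (\<forall>i\<in>{1..N}. deviation N x i = 0)"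
  using assms by (simp add: variance_eq_sum_deviation sum_nonneg_eq_0_iff)

lemma variance_pos_iff:
  assumes N: "N > 0"
  shows "variance N x > 0 \<longleftrightarrow> \<not> consensus N x"
proof -
  have "deviation N x i = 0" if "consensus N x" "i \<in> {1..N}" for i
  proof -
    have "(\<Sum>j=1..N. x j) = (\<Sum>j=1..N. x i)"
      using that unfolding consensus_def by (intro sum.cong refl) blast
    then show ?thesis
      using N by (simp add: deviation_def mean_def sum_constant_scaleR del: sum_constant)
  qed
  moreover have "consensus N x" if "\<forall>i\<in>{1..N}. deviation N x i = 0"
    using that by (auto simp: consensus_def deviation_def)
  ultimately show ?thesis
    using variance_eq_0_iff_deviation[OF N, of x] variance_nonneg[of N x] by force
qed

lemma norm_deviation_le:
  assumes N: "N > 0" and i: "i \<in> {1..N}"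
  shows "(norm (deviation N x i))\<^sup>2 \<le> 2 * real N * variance N x"
proof -
  have "(norm (deviation N x i))\<^sup>2 \<le> (\<Sum>i=1..N. (norm (deviation N x i))\<^sup>2)"
    using i by (intro member_le_sum) auto
  then show ?thesis
    using N by (simp add: variance_eq_sum_deviation)
qed

text \<open>The squared norm lies above its tangent at each \<open>deviation N x i\<close>. The
  motion of the mean can be included in \<open>y i - x i\<close> at no cost, because it is paired
  with the sum of the deviations, which is zero.\<close>

lemma variance_diff_ge:
  fixes x y :: "nat \<Rightarrow> real^'d"
  assumes N: "N > 0"
  shows "real N * (variance N y - variance N x) \<ge> (\<Sum>i=1..N. deviation N x i \<bullet> (y i - x i))"
proof -
  let ?R = "deviation N x" and ?S = "deviation N y"
  have conv: "(norm (?S i))\<^sup>2 - (norm (?R i))\<^sup>2 \<ge> 2 * (?R i \<bullet> (?S i - ?R i))" for i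
  proof -
    have "(norm (?S i - ?R i))\<^sup>2 \<ge> 0"
      by simp
    then show ?thesis
      unfolding power2_norm_eq_inner by (simp add: inner_diff inner_commute)
  qed
  have "y i - x i = (?S i - ?R i) + (mean N y - mean N x)" for i
    by (simp add: deviation_def)
  then have "(\<Sum>i=1..N. ?R i \<bullet> (y i - x i))
      = (\<Sum>i=1..N. ?R i \<bullet> (?S i - ?R i)) + (\<Sum>i=1..N. ?R i) \<bullet> (mean N y - mean N x)"
    by (simp add: inner_add_right inner_sum_left sum.distrib)
  also have "\<dots> = (\<Sum>i=1..N. ?R i \<bullet> (?S i - ?R i))"
    using sum_deviation[OF N, of x] by simp
  also have "\<dots> \<le> (\<Sum>i=1..N. ((norm (?S i))\<^sup>2 - (norm (?R i))\<^sup>2) / 2)"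
    using conv by (intro sum_mono) (simp add: mult.commute)
  also have "\<dots> = real N * (variance N y - variance N x)"
    using N by (simp add: variance_eq_sum_deviation sum_subtractf sum_divide_distrib[symmetric]
        right_diff_distrib diff_divide_distrib)
  finally show ?thesis .
qed

section \<open>Estimates of the velocity near consensus\<close>

text \<open>A term for agents at distance \<open>s > 0\<close> has norm
  \<open>\<bar>s * a s\<bar>\<close>, and \<open>s < r\<close> because both deviations are below
  \<open>r / 2\<close>. Terms of coinciding agents vanish. At most \<open>N\<close> terms are
  averaged with weight \<open>1 / N\<close>.\<close>

lemma norm_interaction_le:
  fixes x :: "nat \<Rightarrow> real^'d"
  assumes N: "N > 0" and eps: "e \<ge> 0"
    and a: "\<And>s. 0 < s \<Longrightarrow> s < r \<Longrightarrow> \<bar>s * a s\<bar> \<le> e"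
    and near: "\<And>i. i \<in> {1..N} \<Longrightarrow> norm (deviation N x i) < r / 2"
    and i: "i \<in> {1..N}"
  shows "norm (interaction a N x i) \<le> e"
proof -
  have term_le: "norm (a (norm (x i - x j)) *\<^sub>R (x j - x i)) \<le> e" if j: "j \<in> {1..N}" for j
  proof (cases "x i = x j")
    case False
    have "norm (x i - x j) < r"
      using norm_triangle_ineq4[of "deviation N x i" "deviation N x j"] near[OF i] near[OF j]
      by (simp add: diff_eq_deviation[of x i j N])
    then show ?thesis
      using a[of "norm (x i - x j)"] False
      by (simp add: abs_mult norm_minus_commute mult.commute)
  qed (simp add: eps)
  have "norm (\<Sum>j\<in>{1..N}-{i}. a (norm (x i - x j)) *\<^sub>R (x j - x i))
      \<le> (\<Sum>j\<in>{1..N}-{i}. e)"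
    by (intro sum_norm_le term_le) auto
  also have "\<dots> \<le> real N * e"
    using eps i by (simp add: mult_right_mono)
  finally show ?thesis
    using N by (simp add: interaction_def field_simps)
qed

text \<open>\<open>R\<close> stands for the deviations frozen at an earlier time, so replacing them
  by the current ones costs an error, weighted by the velocity bound \<open>2 * M\<close>. The bound
  uses an arbitrary \<open>k\<close> instead of the maximizing index, since the latter may jump with
  time while a fixed \<open>k\<close> gives a bound continuous in the state.\<close>

lemma velocity_inner_ge:
  fixes x u R :: "nat \<Rightarrow> real^'d"
  assumes N: "N > 0" and M: "M > 0"
    and fb: "sparse_feedback M N x u"
    and a: "\<And>s. 0 < s \<Longrightarrow> s < r \<Longrightarrow> \<bar>s * a s\<bar> \<le> M / (2 * real N)"
    and near: "\<And>i. i \<in> {1..N} \<Longrightarrow> norm (deviation N x i) < r / 2"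
    and k: "k \<in> {1..N}"
  shows "(\<Sum>i=1..N. R i \<bullet> (interaction a N x i + u i))
    \<ge> M / 2 * norm (deviation N x k) - 2 * M * (\<Sum>i=1..N. norm (R i - deviation N x i))"
proof -
  let ?S = "deviation N x"
  let ?f = "\<lambda>i. interaction a N x i + u i"
  obtain m where m: "m \<in> {1..N}" and max: "\<And>i. i \<in> {1..N} \<Longrightarrow> norm (?S i) \<le> norm (?S m)"
    and u: "\<And>i. i \<in> {1..N} \<Longrightarrow>
      u i = (if i = m then (M / norm (?S m)) *\<^sub>R ?S m else 0)"
    using fb unfolding sparse_feedback_def is_arg_max_linorder by blast
  have int: "norm (interaction a N x i) \<le> M / (2 * real N)" if "i \<in> {1..N}" for i
    using N M by (intro norm_interaction_le[OF N _ a near that]) auto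
  have "real N \<ge> 1"
    using N by simp
  then have "M / (2 * real N) \<le> M"
    using M by (simp add: field_simps)
  have f: "norm (?f i) \<le> 2 * M" if "i \<in> {1..N}" for i
  proof -
    have "norm (u i) \<le> M"
      using u[OF that] M by (cases "?S m = 0") auto
    then show ?thesis
      using int[OF that] \<open>M / (2 * real N) \<le> M\<close> norm_triangle_ineq[of "interaction a N x i" "u i"]
      by linarith
  qed
  have Su: "(\<Sum>i=1..N. ?S i \<bullet> u i) = M * norm (?S m)"
  proof -
    have "(\<Sum>i=1..N. ?S i \<bullet> u i) = (\<Sum>i=1..N. if i = m then M * norm (?S m) else 0)"
      using u by (intro sum.cong refl)
        (auto simp: power2_norm_eq_inner[symmetric] power2_eq_square)
    then show ?thesis
      using m by simp
  qed
  \<comment> \<open>Summed over the \<open>N\<close> agents, this loss is at most half of the gain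
    \<open>M * norm (?S m)\<close> from the control.\<close>
  have "?S i \<bullet> interaction a N x i \<ge> - (norm (?S m) * (M / (2 * real N)))"
    if "i \<in> {1..N}" for i
  proof -
    have "\<bar>?S i \<bullet> interaction a N x i\<bar> \<le> norm (?S i) * norm (interaction a N x i)"
      by (rule Cauchy_Schwarz_ineq2)
    also have "\<dots> \<le> norm (?S m) * (M / (2 * real N))"
      using max[OF that] int[OF that] by (intro mult_mono) auto
    finally show ?thesis
      by linarith
  qed
  then have "(\<Sum>i=1..N. - (norm (?S m) * (M / (2 * real N))))
      \<le> (\<Sum>i=1..N. ?S i \<bullet> interaction a N x i)"
    by (intro sum_mono)
  then have "(\<Sum>i=1..N. ?S i \<bullet> interaction a N x i) \<ge> - (M / 2 * norm (?S m))"
    using N by (simp add: field_simps)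
  then have Sf: "(\<Sum>i=1..N. ?S i \<bullet> ?f i) \<ge> M / 2 * norm (?S m)"
    using Su by (simp add: inner_add_right sum.distrib)
  have "\<bar>(R i - ?S i) \<bullet> ?f i\<bar> \<le> norm (R i - ?S i) * (2 * M)" if "i \<in> {1..N}" for i
    using Cauchy_Schwarz_ineq2[of "R i - ?S i" "?f i"] f[OF that]
    by (meson mult_left_mono norm_ge_zero order_trans)
  then have "\<bar>\<Sum>i=1..N. (R i - ?S i) \<bullet> ?f i\<bar> \<le> (\<Sum>i=1..N. norm (R i - ?S i) * (2 * M))"
    by (intro order_trans[OF sum_abs] sum_mono)
  then have diff: "(\<Sum>i=1..N. (R i - ?S i) \<bullet> ?f i) \<ge> - (2 * M * (\<Sum>i=1..N. norm (R i - ?S i)))"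
    by (simp add: sum_distrib_left mult.commute abs_le_iff)
  have "(\<Sum>i=1..N. R i \<bullet> ?f i) = (\<Sum>i=1..N. ?S i \<bullet> ?f i) + (\<Sum>i=1..N. (R i - ?S i) \<bullet> ?f i)"
    by (simp add: inner_diff_left sum_subtractf)
  moreover have "M / 2 * norm (?S m) \<ge> M / 2 * norm (?S k)"
    using max[OF k] M by simp
  ultimately show ?thesis
    using Sf diff by linarith
qed

section \<open>Integral form and continuity of solutions\<close>

lemma solution_on_subset:
  assumes sol: "solution_on a N J x u" and T: "T \<in> J"
  shows "{0..T} \<subseteq> J"
proof -
  have "is_interval J" "0 \<in> J"
    using sol unfolding solution_on_def by blast+
  then show ?thesis
    using T mem_is_interval_1_I[of J 0 T] by auto
qed

text \<open>\<open>solution_on\<close> supplies integrals starting at \<open>0\<close>; additivity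
  over intervals gives those starting at \<open>t\<close>, as needed for growth estimates after time
  \<open>t\<close>.\<close>

lemma solution_on_has_integral:
  assumes sol: "solution_on a N J x u" and T: "T \<in> J" and i: "i \<in> {1..N}"
    and st: "0 \<le> t" "t \<le> s" "s \<le> T"
  shows "((\<lambda>\<tau>. interaction a N (x \<tau>) i + u \<tau> i) has_integral (x s i - x t i)) {t..s}"
proof -
  let ?f = "\<lambda>\<tau>. interaction a N (x \<tau>) i + u \<tau> i"
  have "s \<in> J" "t \<in> J"
    using solution_on_subset[OF sol T] st by auto
  then have t: "(?f has_integral (x t i - x 0 i)) {0..t}"
    and s: "(?f has_integral (x s i - x 0 i)) {0..s}"
    using sol i unfolding solution_on_def by auto
  have "?f integrable_on {t..s}"
    using st by (intro integrable_on_subinterval[OF has_integral_integrable[OF s]]) auto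
  then have "(?f has_integral ((x t i - x 0 i) + integral {t..s} ?f)) {0..s}"
    using has_integral_combine[OF st(1,2) t integrable_integral] by simp
  then have "x t i - x 0 i + integral {t..s} ?f = x s i - x 0 i"
    using s has_integral_unique by blast
  then have "integral {t..s} ?f = x s i - x t i"
    by (simp add: algebra_simps)
  then show ?thesis
    using \<open>?f integrable_on {t..s}\<close> by (metis integrable_integral)
qed

lemma solution_on_continuous:
  assumes sol: "solution_on a N J x u" and T: "T \<in> J" and i: "i \<in> {1..N}"
  shows "continuous_on {0..T} (\<lambda>t. x t i)"
proof -
  let ?f = "\<lambda>\<tau>. interaction a N (x \<tau>) i + u \<tau> i"
  have J: "{0..T} \<subseteq> J"
    by (rule solution_on_subset[OF sol T])
  have int: "(?f has_integral (x t i - x 0 i)) {0..t}" if "t \<in> J" for t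
    using sol i that unfolding solution_on_def by auto
  have "continuous_on {0..T} (\<lambda>t. x 0 i + integral {0..t} ?f)"
    using int[OF T] by (intro continuous_intros indefinite_integral_continuous_1) blast
  moreover have "x 0 i + integral {0..t} ?f = x t i" if "t \<in> {0..T}" for t
    using integral_unique[OF int] J that by force
  ultimately show ?thesis
    by (rule continuous_on_eq)
qed

lemma continuous_on_deviation:
  assumes "\<And>i. i \<in> {1..N} \<Longrightarrow> continuous_on S (\<lambda>t. x t i)" and "i \<in> {1..N}"
  shows "continuous_on S (\<lambda>t. deviation N (x t) i)"
  unfolding deviation_def mean_def using assms by (intro continuous_intros) auto

lemma continuous_on_variance:
  assumes "\<And>i. i \<in> {1..N} \<Longrightarrow> continuous_on S (\<lambda>t. x t i)"
  shows "continuous_on S (\<lambda>t. variance N (x t))"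
  unfolding variance_def using assms by (intro continuous_intros) auto

section \<open>Local growth of the variance\<close>

text \<open>The lower bound of \<open>velocity_inner_ge\<close>, with \<open>R\<close> frozen at
  \<open>t\<close>, is positive at \<open>t\<close> and continuous in time, so it stays above a
  constant \<open>c > 0\<close> shortly after \<open>t\<close>. Integrating it and applying
  \<open>variance_diff_ge\<close> gives growth at least linear in the elapsed time.\<close>

lemma variance_increases_right:
  fixes x u :: "real \<Rightarrow> nat \<Rightarrow> real^'d"
  assumes N: "N > 0" and M: "M > 0"
    and sol: "solution_on a N J x u" and fb: "\<And>t. t \<in> J \<Longrightarrow> sparse_feedback M N (x t) (u t)"
    and a: "\<And>s. 0 < s \<Longrightarrow> s < r \<Longrightarrow> \<bar>s * a s\<bar> \<le> M / (2 * real N)"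
    and T: "T \<in> J" and t: "0 \<le> t" "t < T"
    and pos: "variance N (x t) > 0"
    and near: "\<And>i. i \<in> {1..N} \<Longrightarrow> norm (deviation N (x t) i) < r / 2"
  shows "\<exists>s. t < s \<and> s \<le> T \<and> (\<forall>\<tau>. t < \<tau> \<and> \<tau> \<le> s \<longrightarrow> variance N (x \<tau>) > variance N (x t))"
proof -
  let ?R = "\<lambda>t. deviation N (x t)"
  have J: "{0..T} \<subseteq> J"
    by (rule solution_on_subset[OF sol T])
  have tT: "t \<in> {0..T}"
    using t by simp
  have lim: "((\<lambda>\<tau>. ?R \<tau> i) \<longlongrightarrow> ?R t i) (at t within {0..T})" if "i \<in> {1..N}" for i
    using continuous_on_deviation[where x = x, OF solution_on_continuous[OF sol T] that] tT
    unfolding continuous_on_def by blast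
  obtain k where k: "k \<in> {1..N}" and Rk: "?R t k \<noteq> 0"
    using pos variance_eq_0_iff_deviation[OF N, of "x t"] by force
  \<comment> \<open>Half of the value of \<open>?h\<close> at \<open>t\<close>, where the error sum
    vanishes; the other half is the margin for continuity.\<close>
  define c where "c = M / 4 * norm (?R t k)"
  have c: "c > 0"
    using M Rk by (simp add: c_def)
  let ?h = "\<lambda>\<tau>. M / 2 * norm (?R \<tau> k) - 2 * M * (\<Sum>i=1..N. norm (?R t i - ?R \<tau> i))"
  have "(?h \<longlongrightarrow> M / 2 * norm (?R t k) - 2 * M * (\<Sum>i=1..N. norm (?R t i - ?R t i)))
      (at t within {0..T})"
    by (intro tendsto_intros lim k) auto
  moreover have "M / 2 * norm (?R t k) - 2 * M * (\<Sum>i=1..N. norm (?R t i - ?R t i)) > c"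
    using c by (simp add: c_def)
  ultimately have "\<forall>\<^sub>F \<tau> in at t within {0..T}. ?h \<tau> > c"
    using order_tendstoD(1) by blast
  moreover have "\<forall>\<^sub>F \<tau> in at t within {0..T}. \<forall>i\<in>{1..N}. norm (?R \<tau> i) < r / 2"
    using order_tendstoD(2)[OF tendsto_norm[OF lim] near]
    by (intro eventually_ball_finite) auto
  ultimately have "\<forall>\<^sub>F \<tau> in at t within {0..T}. ?h \<tau> > c \<and> (\<forall>i\<in>{1..N}. norm (?R \<tau> i) < r / 2)"
    by eventually_elim simp
  then obtain d where d: "d > 0"
    and good: "\<And>\<tau>. \<tau> \<in> {0..T} \<Longrightarrow> \<tau> \<noteq> t \<Longrightarrow> dist \<tau> t < d \<Longrightarrow>
      ?h \<tau> > c \<and> (\<forall>i\<in>{1..N}. norm (?R \<tau> i) < r / 2)"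
    unfolding eventually_at by blast
  \<comment> \<open>The filter \<open>at t within\<close> omits the point \<open>t\<close>, which is
    added here so that the bounds hold on a closed interval of integration.\<close>
  have good': "?h \<tau> \<ge> c" "\<forall>i\<in>{1..N}. norm (?R \<tau> i) < r / 2"
    if "t \<le> \<tau>" "\<tau> \<le> T" "\<tau> < t + d" for \<tau>
  proof -
    have "?h t > c"
      using c by (simp add: c_def)
    then show "?h \<tau> \<ge> c" "\<forall>i\<in>{1..N}. norm (?R \<tau> i) < r / 2"
      using good[of \<tau>] that t near by (cases "\<tau> = t"; force simp: dist_real_def)+
  qed
  define s where "s = min T (t + d / 2)"
  have s: "t < s" "s \<le> T" "s < t + d"
    using t d by (auto simp: s_def)
  have "variance N (x \<tau>) > variance N (x t)" if \<tau>: "t < \<tau>" "\<tau> \<le> s" for \<tau>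
  proof -
    \<comment> \<open>The vectors \<open>?R t i\<close> do not depend on the integration variable,
      so the integral of \<open>?G\<close> follows by linearity from those of the
      velocities.\<close>
    let ?G = "\<lambda>\<sigma>. \<Sum>i=1..N. ?R t i \<bullet> (interaction a N (x \<sigma>) i + u \<sigma> i)"
    have "(?G has_integral (\<Sum>i=1..N. ?R t i \<bullet> (x \<tau> i - x t i))) {t..\<tau>}"
    proof (intro has_integral_sum)
      fix i assume "i \<in> {1..N}"
      then show "((\<lambda>\<sigma>. ?R t i \<bullet> (interaction a N (x \<sigma>) i + u \<sigma> i)) has_integral
          ?R t i \<bullet> (x \<tau> i - x t i)) {t..\<tau>}"
        using has_integral_linear[OF solution_on_has_integral[OF sol T _ t(1)]
            bounded_linear_inner_right] \<tau> s by (auto simp: o_def)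
    qed simp
    moreover have "((\<lambda>\<sigma>. c) has_integral c * (\<tau> - t)) {t..\<tau>}"
      using has_integral_const_real[of c t \<tau>] \<tau> by (simp add: mult.commute)
    moreover have "c \<le> ?G \<sigma>" if "\<sigma> \<in> {t..\<tau>}" for \<sigma>
    proof -
      have \<sigma>: "t \<le> \<sigma>" "\<sigma> \<le> T" "\<sigma> < t + d" "\<sigma> \<in> J"
        using that \<tau> s t J by auto
      have "c \<le> ?h \<sigma>"
        using good'(1) \<sigma> by blast
      also have "\<dots> \<le> ?G \<sigma>"
        using good'(2)[OF \<sigma>(1-3)] by (intro velocity_inner_ge[OF N M fb a _ k] \<sigma>) auto
      finally show ?thesis .
    qed
    ultimately have "c * (\<tau> - t) \<le> (\<Sum>i=1..N. ?R t i \<bullet> (x \<tau> i - x t i))"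
      using has_integral_le by blast
    also have "\<dots> \<le> real N * (variance N (x \<tau>) - variance N (x t))"
      by (rule variance_diff_ge[OF N])
    finally have "real N * (variance N (x \<tau>) - variance N (x t)) > 0"
      using c \<tau> by (smt (verit) mult_pos_pos)
    then show ?thesis
      using N by (simp add: zero_less_mult_iff)
  qed
  with s show ?thesis
    by blast
qed

section \<open>A barrier argument for continuous real functions\<close>

text \<open>A crossing of \<open>w\<close> from above would have a last time at which \<open>g = w\<close>.\<close>

lemma level_barrier:
  fixes g :: "real \<Rightarrow> real"
  assumes cont: "continuous_on {p..q} g" and pq: "p \<le> q" and gp: "w \<le> g p"
    and incr: "\<And>t. p \<le> t \<Longrightarrow> t < q \<Longrightarrow> g t = w \<Longrightarrow>
      \<exists>s. t < s \<and> s \<le> q \<and> (\<forall>\<tau>. t < \<tau> \<and> \<tau> \<le> s \<longrightarrow> w < g \<tau>)"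
  shows "w \<le> g q"
proof (rule ccontr)
  assume gq: "\<not> w \<le> g q"
  let ?S = "{t \<in> {p..q}. w \<le> g t}"
  have "closed ?S"
    using continuous_closed_preimage[OF cont closed_real_atLeastAtMost closed_atLeast[of w]]
    by (simp add: vimage_def Int_def)
  then have "compact ?S"
    using bounded_subset[OF bounded_closed_interval, of ?S p q]
    by (simp add: compact_eq_bounded_closed subset_eq)
  moreover have "?S \<noteq> {}"
    using pq gp by force
  ultimately obtain t where t: "t \<in> ?S" and last: "\<And>s. s \<in> ?S \<Longrightarrow> s \<le> t"
    using compact_attains_sup[of ?S] by blast
  have "t < q"
    using t gq by (cases "t = q") auto
  \<comment> \<open>The intermediate value theorem yields a point of level \<open>w\<close> at or
    after \<open>t\<close>. Since \<open>t\<close> is the last point of \<open>?S\<close>, that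
    point is \<open>t\<close> itself, hence \<open>g t = w\<close> and \<open>incr\<close>
    applies.\<close>
  have "continuous_on {t..q} g"
    using cont t by (elim continuous_on_subset) auto
  then obtain t' where t': "t \<le> t'" "t' \<le> q" "g t' = w"
    using IVT2'[of g q w t] t gq \<open>t < q\<close> by auto
  then have "t' = t"
    using last[of t'] t by force
  then obtain s where "t < s" "s \<le> q" "w < g s"
    using incr[of t] t t' \<open>t < q\<close> by auto
  then show False
    using last[of s] t by force
qed

section \<open>Global consequences for the closed loop\<close>

theorem theorem1p8:
  fixes a :: "real \<Rightarrow> real" and M :: real and N :: nat
    and F :: "(nat \<Rightarrow> real^'d) \<Rightarrow> (nat \<Rightarrow> real^'d) \<Rightarrow> bool"
  assumes "N \<ge> 2"
    and "\<And>s. s \<ge> 0 \<Longrightarrow> a s \<ge> 0"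
    and "((\<lambda>s. s * a s) \<longlongrightarrow> 0) (at_right 0)"
    and "M > 0"
    and "F = sparse_feedback M N"
  shows "prevents_consensus a N F \<and>
    (\<exists>\<delta>>0. \<forall>J x. closed_loop_solution a N F J x \<and>
        0 < variance N (x 0) \<and> variance N (x 0) \<le> \<delta> \<longrightarrow>
        (\<forall>t\<in>J. t > 0 \<longrightarrow> variance N (x t) > variance N (x 0)))"
proof -
  have N: "N > 0"
    using assms(1) by simp
  have "M / (2 * real N) > 0"
    using N assms(4) by simp
  then have "\<forall>\<^sub>F s in at_right 0. \<bar>s * a s\<bar> < M / (2 * real N)"
    using tendstoD[OF assms(3)] by (simp add: dist_real_def)
  then obtain r where r: "r > 0" and a: "\<And>s. 0 < s \<Longrightarrow> s < r \<Longrightarrow> \<bar>s * a s\<bar> \<le> M / (2 * real N)"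
    unfolding eventually_at_right_field by (meson less_imp_le)
  \<comment> \<open>With variance at most \<open>D\<close>, \<open>norm_deviation_le\<close> bounds
    each squared deviation by \<open>2 * N * D = r\<^sup>2 / 8\<close>, which is less than
    \<open>(r / 2)\<^sup>2\<close>.\<close>
  define D where "D = r\<^sup>2 / (16 * real N)"
  have D: "D > 0"
    using r N by (simp add: D_def)
  have near: "norm (deviation N y i) < r / 2" if "variance N y \<le> D" "i \<in> {1..N}"
    for y :: "nat \<Rightarrow> real^'d" and i
  proof -
    have "(norm (deviation N y i))\<^sup>2 \<le> 2 * real N * D"
      using norm_deviation_le[OF N that(2), of y] mult_left_mono[OF that(1), of "2 * real N"]
      by simp
    also have "\<dots> < (r / 2)\<^sup>2"
      using N r by (simp add: D_def power_divide field_simps)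
    finally show ?thesis
      by (rule power_less_imp_less_base) (use r in simp)
  qed
  have incr: "\<exists>s. t < s \<and> s \<le> T \<and> (\<forall>\<tau>. t < \<tau> \<and> \<tau> \<le> s \<longrightarrow> variance N (x \<tau>) > variance N (x t))"
    if cl: "closed_loop_solution a N F J x" and t: "T \<in> J" "0 \<le> t" "t < T"
      "0 < variance N (x t)" and le: "variance N (x t) \<le> D" for J x t T
  proof -
    obtain u where sol: "solution_on a N J x u"
      and fb: "\<And>t. t \<in> J \<Longrightarrow> sparse_feedback M N (x t) (u t)"
      using cl assms(5) unfolding closed_loop_solution_def by blast
    show ?thesis
      by (rule variance_increases_right[OF N assms(4) sol fb a t near[OF le]])
  qed
  have barrier: "w \<le> variance N (x T)"
    if cl: "closed_loop_solution a N F J x" and "T \<in> J" "0 \<le> s" "s \<le> T"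
      "0 < w" "w \<le> D" "w \<le> variance N (x s)" for J x s T w
  proof (rule level_barrier[of s T "\<lambda>t. variance N (x t)"])
    obtain u where "solution_on a N J x u"
      using cl unfolding closed_loop_solution_def by blast
    then have "continuous_on {0..T} (\<lambda>t. variance N (x t))"
      using solution_on_continuous \<open>T \<in> J\<close> by (intro continuous_on_variance) blast
    then show "continuous_on {s..T} (\<lambda>t. variance N (x t))"
      using \<open>0 \<le> s\<close> by (elim continuous_on_subset) auto
    show "\<exists>s'. t < s' \<and> s' \<le> T \<and> (\<forall>\<tau>. t < \<tau> \<and> \<tau> \<le> s' \<longrightarrow> w < variance N (x \<tau>))"
      if "s \<le> t" "t < T" "variance N (x t) = w" for t
      using incr[OF cl \<open>T \<in> J\<close>, of t] that \<open>0 \<le> s\<close> \<open>0 < w\<close> \<open>w \<le> D\<close> by auto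
  qed (use that in auto)
  have J0: "0 \<le> t" if "closed_loop_solution a N F J x" "t \<in> J" for J x t
    using that unfolding closed_loop_solution_def solution_on_def by auto
  have "prevents_consensus a N F"
    unfolding prevents_consensus_def
  proof (intro allI impI, elim conjE)
    fix J x
    assume cl: "closed_loop_solution a N F J x" and nc: "\<not> consensus N (x 0)"
    \<comment> \<open>The initial variance may be large, whereas only levels up to \<open>D\<close>
      are known to be barriers.\<close>
    define w where "w = min (variance N (x 0)) D"
    have w: "0 < w" "w \<le> D" "w \<le> variance N (x 0)"
      using D nc variance_pos_iff[OF N, of "x 0"] by (auto simp: w_def)
    have ge: "w \<le> variance N (x t)" if "t \<in> J" for t
      using barrier[OF cl that order_refl J0[OF cl that] w] .
    have "\<not> consensus N (x t)" if "t \<in> J" for t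
      using ge[OF that] w(1) variance_pos_iff[OF N, of "x t"] by linarith
    moreover have "\<not> ((\<lambda>t. variance N (x t)) \<longlongrightarrow> 0) at_top" if "J = {0..}"
    proof
      assume "((\<lambda>t. variance N (x t)) \<longlongrightarrow> 0) at_top"
      then have "\<forall>\<^sub>F t in at_top. variance N (x t) < w"
        using order_tendstoD(2) w(1) by blast
      then obtain T where T: "\<And>t. t \<ge> T \<Longrightarrow> variance N (x t) < w"
        unfolding eventually_at_top_linorder by blast
      have "variance N (x (max 0 T)) < w"
        by (rule T) simp
      moreover have "w \<le> variance N (x (max 0 T))"
        by (rule ge) (simp add: that)
      ultimately show False
        by simp
    qed
    ultimately show "(\<forall>t\<in>J. \<not> consensus N (x t)) \<and>
        (J = {0..} \<longrightarrow> \<not> ((\<lambda>t. variance N (x t)) \<longlongrightarrow> 0) at_top)"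
      by blast
  qed
  moreover have "variance N (x t) > variance N (x 0)"
    if cl: "closed_loop_solution a N F J x" and init: "0 < variance N (x 0)"
      "variance N (x 0) \<le> D / 2" and t: "t \<in> J" "t > 0" for J x t
  proof -
    \<comment> \<open>The variance first rises strictly at some \<open>s\<close>, and then a barrier
      above the initial value keeps it there. The level is capped at \<open>D\<close>, and it still
      exceeds the initial variance because the latter is at most \<open>D / 2 < D\<close>.\<close>
    obtain s where s: "0 < s" "s \<le> t" "variance N (x s) > variance N (x 0)"
      using incr[OF cl t(1) order_refl t(2)] init D by auto
    have "min (variance N (x s)) D \<le> variance N (x t)"
      using init D s by (intro barrier[OF cl t(1), of s]) auto
    then show ?thesis
      using s init D by auto
  qed
  moreover have "D / 2 > 0"
    using D by simp
  ultimately show ?thesis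
    by blast
qed

end
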